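(* Let $\mathcal{A}$ and $\mathcal{B}$ be isomorphic equivalence structures with generic character $\{1\}$ (that is, the set of elements of $\mathcal{A}$ whose equivalence class is a singleton and the set of elements of $\mathcal{B}$ whose equivalence class is a singleton both have asymptotic density one). Then $\mathcal{A}$ and $\mathcal{B}$ are coarsely computably isomorphic.
   Context: Structures have universe $\omega$; an equivalence structure is a set with an equivalence relation on it. A set $S\subseteq\omega$ has asymptotic density $\delta$ if $\lim_{n\to\infty} |S\cap\{0,\dots,n\}|/(n+1)=\delta$. An isomorphism $f:\mathcal{A}\to\mathcal{B}$ between two structures is a coarsely computable isomorphism if there is a total computable function $\theta$ such that the set $C=\{x:\theta(x)=f(x)\}$ has asymptotic density one and the image $f[C]$ also has asymptotic density one. $\mathcal{A}$ and $\mathcal{B}$ are coarsely computably isomorphic if there is a coarsely computable isomorphism from $\mathcal{A}$ to $\mathcal{B}$. *)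

theory Defs
  imports Complex_Main
begin

text \<open>
  Partial recursive functions as codes with a denotation. The codes carry no arity: a function is
  applied to an argument list of any length, and \<^term>\<open>None\<close> stands for divergence.
  \<open>Prec\<close> recurses on the first argument and \<open>Mu\<close> minimizes over the first argument; as usual,
  minimization diverges if some value before the first zero is undefined.
\<close>

datatype recfn = Zero | Succ | Proj nat | Comp recfn "recfn list" | Prec recfn recfn | Mu recfn

fun recfn_eval :: "recfn \<Rightarrow> nat list \<Rightarrow> nat option" where
  "recfn_eval Zero xs = Some 0"
| "recfn_eval Succ xs = (case xs of [] \<Rightarrow> None | x # ys \<Rightarrow> Some (Suc x))"
| "recfn_eval (Proj i) xs = (if i < length xs then Some (xs ! i) else None)"
| "recfn_eval (Comp f gs) xs =
     Option.bind (those (map (\<lambda>g. recfn_eval g xs) gs)) (\<lambda>ys. recfn_eval f ys)"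
| "recfn_eval (Prec f g) xs =
     (case xs of
        [] \<Rightarrow> None
      | n # ys \<Rightarrow>
          rec_nat (recfn_eval f ys)
            (\<lambda>k r. Option.bind r (\<lambda>y. recfn_eval g (k # y # ys))) n)"
| "recfn_eval (Mu f) xs =
     (if \<exists>n. recfn_eval f (n # xs) = Some 0 \<and>
             (\<forall>m<n. recfn_eval f (m # xs) \<noteq> None)
      then Some (LEAST n. recfn_eval f (n # xs) = Some 0)
      else None)"

definition total_computable :: "(nat \<Rightarrow> nat) \<Rightarrow> bool" where
  "total_computable \<theta> \<longleftrightarrow> (\<exists>r. \<forall>x. recfn_eval r [x] = Some (\<theta> x))"

definition has_asymptotic_density :: "nat set \<Rightarrow> real \<Rightarrow> bool" where
  "has_asymptotic_density S \<delta> \<longleftrightarrow>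
     (\<lambda>n. real (card (S \<inter> {0..n})) / (real n + 1)) \<longlonglongrightarrow> \<delta>"

text \<open>
  A structure with universe \<open>\<omega>\<close> is represented by its relation on \<^typ>\<open>nat\<close>; no computability of
  the relation is assumed.
\<close>

definition equivalence_structure :: "nat rel \<Rightarrow> bool" where
  "equivalence_structure A \<longleftrightarrow> equiv UNIV A"

definition structure_iso :: "nat rel \<Rightarrow> nat rel \<Rightarrow> (nat \<Rightarrow> nat) \<Rightarrow> bool" where
  "structure_iso A B f \<longleftrightarrow> bij f \<and> (\<forall>x y. (x, y) \<in> A \<longleftrightarrow> (f x, f y) \<in> B)"

definition isomorphic :: "nat rel \<Rightarrow> nat rel \<Rightarrow> bool" where
  "isomorphic A B \<longleftrightarrow> (\<exists>f. structure_iso A B f)"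

definition generic_character_one :: "nat rel \<Rightarrow> bool" where
  "generic_character_one A \<longleftrightarrow> has_asymptotic_density {x. is_singleton (A `` {x})} 1"

definition coarsely_computable_iso :: "nat rel \<Rightarrow> nat rel \<Rightarrow> (nat \<Rightarrow> nat) \<Rightarrow> bool" where
  "coarsely_computable_iso A B f \<longleftrightarrow>
     structure_iso A B f \<and>
     (\<exists>\<theta>. total_computable \<theta> \<and>
          has_asymptotic_density {x. \<theta> x = f x} 1 \<and>
          has_asymptotic_density (f ` {x. \<theta> x = f x}) 1)"

definition coarsely_computably_isomorphic :: "nat rel \<Rightarrow> nat rel \<Rightarrow> bool" where
  "coarsely_computably_isomorphic A B \<longleftrightarrow> (\<exists>f. coarsely_computable_iso A B f)"

end

theory Submission
  imports Defs "HOL-Library.Infinite_Set" "HOL-Real_Asymp.Real_Asymp"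
begin

text \<open>
  The coarsely computable isomorphism is the identity almost everywhere. Let \<open>S\<close> and \<open>T\<close> be the
  sets of elements with singleton class in \<open>A\<close> and in \<open>B\<close>. Both have density one, hence so has
  \<open>S \<inter> T\<close>, and there the identity respects both equivalence relations.

  Any isomorphism \<open>h\<close> from \<open>A\<close> to \<open>B\<close> maps the complement of \<open>S\<close> onto the complement of \<open>T\<close>, and
  on \<open>S\<close> it can be replaced by an arbitrary bijection from \<open>S\<close> to \<open>T\<close>, because singleton classes
  carry no further structure (lemma \<open>structure_iso_replace_on_singletons\<close>). The identity on
  \<open>S \<inter> T\<close> need not extend to such a bijection, since \<open>S - T\<close> and \<open>T - S\<close> may have different
  cardinalities. To make room, an infinite set \<open>D \<subseteq> S \<inter> T\<close> of density zero is given up (lemma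
  \<open>infinite_subset_density_zero\<close>): then \<open>S\<close> and \<open>T\<close> both consist of the common part \<open>S \<inter> T - D\<close>
  and a countably infinite remainder, and the remainders can be matched arbitrarily. The
  resulting isomorphism agrees with the computable identity function on a set containing
  \<open>S \<inter> T - D\<close>, which has density one. The set of fixed points is its own image, so the image
  has density one as well.
\<close>

section \<open>Asymptotic density zero and one\<close>

text \<open>
  Density one is treated through null complements, for which unions and subsets are immediate.
\<close>

lemma has_asymptotic_density_one_iff_compl:
  "has_asymptotic_density S 1 \<longleftrightarrow> has_asymptotic_density (- S) 0"
proof -
  have *: "real (card (- S \<inter> {0..n})) / (real n + 1) = 1 - real (card (S \<inter> {0..n})) / (real n + 1)"
    for n
  proof -
    have "card (S \<inter> {0..n}) + card (- S \<inter> {0..n}) = card ((S \<inter> {0..n}) \<union> (- S \<inter> {0..n}))"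
      by (intro card_Un_disjoint[symmetric]) auto
    also have "(S \<inter> {0..n}) \<union> (- S \<inter> {0..n}) = {0..n}"
      by auto
    finally have "real (card (S \<inter> {0..n})) + real (card (- S \<inter> {0..n})) = real n + 1"
      by (simp flip: of_nat_add)
    then show ?thesis
      by (simp add: field_simps)
  qed
  show ?thesis
    unfolding has_asymptotic_density_def *
    using tendsto_diff[OF tendsto_const[of 1],
        of "\<lambda>n. real (card (S \<inter> {0..n})) / (real n + 1)" 1 sequentially]
      tendsto_diff[OF tendsto_const[of 1],
        of "\<lambda>n. 1 - real (card (S \<inter> {0..n})) / (real n + 1)" 0 sequentially]
    by auto
qed

lemma has_asymptotic_density_zero_mono:
  assumes "has_asymptotic_density T 0" and "S \<subseteq> T"
  shows "has_asymptotic_density S 0"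
  unfolding has_asymptotic_density_def
proof (rule tendsto_sandwich[OF _ _ tendsto_const assms(1)[unfolded has_asymptotic_density_def]])
  have "card (S \<inter> {0..n}) \<le> card (T \<inter> {0..n})" for n
    using assms(2) by (intro card_mono) auto
  then show "\<forall>\<^sub>F n in sequentially. real (card (S \<inter> {0..n})) / (real n + 1)
      \<le> real (card (T \<inter> {0..n})) / (real n + 1)"
    by (intro always_eventually allI divide_right_mono) auto
qed auto

lemma has_asymptotic_density_zero_Un:
  assumes "has_asymptotic_density S 0" and "has_asymptotic_density T 0"
  shows "has_asymptotic_density (S \<union> T) 0"
proof -
  have lim: "(\<lambda>n. real (card (S \<inter> {0..n})) / (real n + 1)
      + real (card (T \<inter> {0..n})) / (real n + 1)) \<longlonglongrightarrow> 0"
    using tendsto_add[OF assms[unfolded has_asymptotic_density_def]] by simp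
  have "real (card ((S \<union> T) \<inter> {0..n})) / (real n + 1)
      \<le> real (card (S \<inter> {0..n})) / (real n + 1) + real (card (T \<inter> {0..n})) / (real n + 1)" for n
  proof -
    have "card ((S \<union> T) \<inter> {0..n}) \<le> card (S \<inter> {0..n}) + card (T \<inter> {0..n})"
      by (simp add: Int_Un_distrib2 card_Un_le)
    then show ?thesis
      by (simp add: divide_right_mono flip: add_divide_distrib of_nat_add)
  qed
  then show ?thesis
    unfolding has_asymptotic_density_def
    by (intro tendsto_sandwich[OF _ _ tendsto_const lim]) auto
qed

lemma infinite_if_density_one:
  assumes "has_asymptotic_density S 1"
  shows "infinite S"
proof
  assume fin: "finite S"
  have "(\<lambda>n. real (card (S \<inter> {0..n})) / (real n + 1)) \<longlonglongrightarrow> 0"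
  proof (rule tendsto_sandwich[OF _ _ tendsto_const])
    show "\<forall>\<^sub>F n in sequentially. real (card (S \<inter> {0..n})) / (real n + 1)
        \<le> real (card S) / (real n + 1)"
      using fin by (intro always_eventually allI divide_right_mono) (auto intro: card_mono)
    show "(\<lambda>n. real (card S) / (real n + 1)) \<longlonglongrightarrow> 0"
      by real_asymp
  qed auto
  with assms show False
    unfolding has_asymptotic_density_def using LIMSEQ_unique zero_neq_one by blast
qed

text \<open>
  Keeping only the elements of \<open>E\<close> whose index in the increasing enumeration is a square
  leaves at most \<open>sqrt n + 1\<close> elements up to \<open>n\<close>.
\<close>

lemma infinite_subset_density_zero:
  assumes "infinite (E :: nat set)"
  obtains D where "D \<subseteq> E" and "infinite D" and "has_asymptotic_density D 0"
proof
  define D where "D = range (\<lambda>k. enumerate E (k\<^sup>2))"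
  show "D \<subseteq> E"
    unfolding D_def using enumerate_in_set[OF assms] by auto
  have "inj (\<lambda>k. enumerate E (k\<^sup>2))"
    using assms by (auto intro!: injI dest!: injD[OF strict_mono_imp_inj_on[OF strict_mono_enumerate]])
  then show "infinite D"
    unfolding D_def by (rule range_inj_infinite)
  have bound: "real (card (D \<inter> {0..n})) \<le> sqrt (real n) + 1" for n
  proof -
    have "D \<inter> {0..n} \<subseteq> (\<lambda>k. enumerate E (k\<^sup>2)) ` {0..nat \<lfloor>sqrt (real n)\<rfloor>}"
    proof
      fix x assume "x \<in> D \<inter> {0..n}"
      then obtain k where k: "x = enumerate E (k\<^sup>2)" "x \<le> n"
        by (auto simp: D_def)
      then have "k\<^sup>2 \<le> n"
        using le_enumerate[OF assms, of "k\<^sup>2"] by simp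
      then have "real k \<le> sqrt (real n)"
        by (intro real_le_rsqrt) (simp flip: of_nat_power)
      then have "k \<le> nat \<lfloor>sqrt (real n)\<rfloor>"
        by (simp add: le_nat_floor)
      with k show "x \<in> (\<lambda>k. enumerate E (k\<^sup>2)) ` {0..nat \<lfloor>sqrt (real n)\<rfloor>}"
        by auto
    qed
    then have "card (D \<inter> {0..n}) \<le> card {0..nat \<lfloor>sqrt (real n)\<rfloor>}"
      by (rule surj_card_le[rotated]) simp
    then have "real (card (D \<inter> {0..n})) \<le> real (Suc (nat \<lfloor>sqrt (real n)\<rfloor>))"
      unfolding of_nat_le_iff by simp
    also have "\<dots> \<le> sqrt (real n) + 1"
      by simp
    finally show ?thesis .
  qed
  show "has_asymptotic_density D 0"
    unfolding has_asymptotic_density_def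
  proof (rule tendsto_sandwich[OF _ _ tendsto_const])
    show "\<forall>\<^sub>F n in sequentially. real (card (D \<inter> {0..n})) / (real n + 1)
        \<le> (sqrt (real n) + 1) / (real n + 1)"
      using bound by (intro always_eventually allI divide_right_mono) auto
    show "(\<lambda>n. (sqrt (real n) + 1) / (real n + 1)) \<longlonglongrightarrow> 0"
      by real_asymp
  qed auto
qed

section \<open>Bijections and isomorphisms\<close>

lemma infinite_nat_sets_bij_betw:
  assumes "infinite (S :: nat set)" and "infinite (T :: nat set)"
  obtains g where "bij_betw g S T"
  using bij_betw_trans[OF bij_betw_inv_into[OF bij_enumerate[OF assms(1)]]
      bij_enumerate[OF assms(2)]] by blast

lemma bij_betw_extending_identity:
  fixes S T E :: "nat set"
  assumes "E \<subseteq> S" and "E \<subseteq> T" and "infinite (S - E)" and "infinite (T - E)"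
  obtains g where "bij_betw g S T" and "\<forall>x\<in>E. g x = x"
proof -
  obtain g where g: "bij_betw g (S - E) (T - E)"
    using infinite_nat_sets_bij_betw[OF assms(3,4)] .
  have "bij_betw (\<lambda>x. if x \<in> E then id x else g x) (E \<union> (S - E)) (E \<union> (T - E))"
    using g by (intro bij_betw_disjoint_Un bij_betw_id) auto
  moreover have "E \<union> (S - E) = S" "E \<union> (T - E) = T"
    using assms(1,2) by auto
  ultimately show ?thesis
    by (intro that[of "\<lambda>x. if x \<in> E then id x else g x"]) auto
qed

lemma structure_iso_is_singleton_iff:
  assumes "structure_iso A B h"
  shows "is_singleton (B `` {h x}) \<longleftrightarrow> is_singleton (A `` {x})"
proof -
  have bij: "bij h" and iff: "\<And>x y. (x, y) \<in> A \<longleftrightarrow> (h x, h y) \<in> B"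
    using assms by (auto simp: structure_iso_def)
  have "B `` {h x} = h ` (A `` {x})"
  proof (intro equalityI subsetI)
    fix z assume "z \<in> B `` {h x}"
    moreover obtain y where "z = h y"
      using bij_is_surj[OF bij] by blast
    ultimately show "z \<in> h ` (A `` {x})"
      using iff by auto
  qed (use iff in auto)
  then show ?thesis
    using card_image[OF inj_on_subset[OF bij_is_inj[OF bij]], of "A `` {x}"]
    by (simp add: is_singleton_altdef)
qed

lemma equivalence_structure_related_to_singleton:
  assumes "equivalence_structure A" and "is_singleton (A `` {x})"
  shows "(x, y) \<in> A \<longleftrightarrow> x = y" and "(y, x) \<in> A \<longleftrightarrow> x = y"
proof -
  have equiv: "equiv UNIV A"
    using assms(1) by (simp add: equivalence_structure_def)
  have "x \<in> A `` {x}"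
    using equiv by (auto simp: equiv_def refl_on_def)
  then have "A `` {x} = {x}"
    using assms(2) by (metis is_singletonE singletonD)
  then show "(x, y) \<in> A \<longleftrightarrow> x = y"
    by (metis Image_singleton_iff singleton_iff)
  moreover have "(y, x) \<in> A \<longleftrightarrow> (x, y) \<in> A"
    using equiv by (auto simp: equiv_def sym_def)
  ultimately show "(y, x) \<in> A \<longleftrightarrow> x = y"
    by simp
qed

text \<open>
  An element with singleton class is related to itself only, so preserving the relation there
  amounts to injectivity together with mapping singleton classes to singleton classes.
\<close>

lemma structure_iso_replace_on_singletons:
  fixes A B :: "nat rel"
  defines "S \<equiv> {x. is_singleton (A `` {x})}" and "T \<equiv> {x. is_singleton (B `` {x})}"
  assumes A: "equivalence_structure A" and B: "equivalence_structure B"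
    and h: "structure_iso A B h" and g: "bij_betw g S T"
  shows "structure_iso A B (\<lambda>x. if x \<in> S then g x else h x)"
proof -
  define f where "f = (\<lambda>x. if x \<in> S then g x else h x)"
  have ST: "h x \<in> T \<longleftrightarrow> x \<in> S" for x
    using structure_iso_is_singleton_iff[OF h] by (simp add: S_def T_def)
  have bij_h: "bij h" and iff: "\<And>x y. (x, y) \<in> A \<longleftrightarrow> (h x, h y) \<in> B"
    using h by (auto simp: structure_iso_def)
  have "h ` (- S) = - T"
  proof (intro equalityI subsetI)
    fix z assume "z \<in> - T"
    moreover obtain y where "z = h y"
      using bij_is_surj[OF bij_h] by blast
    ultimately show "z \<in> h ` (- S)"
      using ST by auto
  qed (use ST in auto)
  then have "bij_betw h (- S) (- T)"
    using inj_on_subset[OF bij_is_inj[OF bij_h]] by (auto simp: bij_betw_def)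
  then have "bij_betw f (S \<union> - S) (T \<union> - T)"
    unfolding f_def using g by (intro bij_betw_disjoint_Un) auto
  then have bij_f: "bij f"
    by simp
  have f_S: "f x \<in> T" if "x \<in> S" for x
    using that g by (auto simp: f_def bij_betw_def)
  have f_eq: "f x = f y \<longleftrightarrow> x = y" for x y
    using bij_f by (auto simp: bij_def inj_eq)
  have rel_S: "(x, y) \<in> A \<longleftrightarrow> x = y" "(y, x) \<in> A \<longleftrightarrow> x = y" if "x \<in> S" for x y
    using equivalence_structure_related_to_singleton[OF A] that by (auto simp: S_def)
  have rel_T: "(x, y) \<in> B \<longleftrightarrow> x = y" "(y, x) \<in> B \<longleftrightarrow> x = y" if "x \<in> T" for x y
    using equivalence_structure_related_to_singleton[OF B] that by (auto simp: T_def)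
  have "(x, y) \<in> A \<longleftrightarrow> (f x, f y) \<in> B" for x y
  proof -
    consider "x \<in> S" | "y \<in> S" | "x \<notin> S" "y \<notin> S"
      by blast
    then show ?thesis
    proof cases
      case 1
      then show ?thesis
        by (simp add: rel_S rel_T f_S f_eq)
    next
      case 2
      then show ?thesis
        by (simp add: rel_S rel_T f_S f_eq)
    next
      case 3
      then show ?thesis
        by (simp add: f_def iff)
    qed
  qed
  with bij_f show ?thesis
    unfolding structure_iso_def f_def by blast
qed

section \<open>The coarsely computable isomorphism\<close>

lemma total_computable_id: "total_computable (\<lambda>x. x)"
  unfolding total_computable_def by (rule exI[of _ "Proj 0"]) simp

lemma coarsely_computable_iso_if_mostly_identity:
  assumes "structure_iso A B f" and "has_asymptotic_density {x. f x = x} 1"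
  shows "coarsely_computable_iso A B f"
proof -
  have "{x. x = f x} = {x. f x = x}" and "f ` {x. f x = x} = {x. f x = x}"
    by force+
  then show ?thesis
    unfolding coarsely_computable_iso_def
    using assms total_computable_id by (intro conjI exI[of _ "\<lambda>x. x"]) auto
qed

theorem theorem4p8:
  fixes A B :: "nat rel"
  assumes "equivalence_structure A" and "equivalence_structure B"
    and "isomorphic A B"
    and "generic_character_one A" and "generic_character_one B"
  shows "coarsely_computably_isomorphic A B"
proof -
  obtain h where h: "structure_iso A B h"
    using assms(3) by (auto simp: isomorphic_def)
  define S where "S = {x. is_singleton (A `` {x})}"
  define T where "T = {x. is_singleton (B `` {x})}"
  have null: "has_asymptotic_density (- S) 0" "has_asymptotic_density (- T) 0"
    using assms(4,5)
    by (simp_all add: generic_character_one_def S_def T_def has_asymptotic_density_one_iff_compl)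
  then have null_ST: "has_asymptotic_density (- (S \<inter> T)) 0"
    using has_asymptotic_density_zero_Un by (simp add: Compl_Int)
  then have "infinite (S \<inter> T)"
    by (intro infinite_if_density_one) (simp add: has_asymptotic_density_one_iff_compl)
  then obtain D where D: "D \<subseteq> S \<inter> T" "infinite D" "has_asymptotic_density D 0"
    by (rule infinite_subset_density_zero)
  define E where "E = S \<inter> T - D"
  \<comment> \<open>Both remainders contain \<open>D\<close>, which is what makes them infinite.\<close>
  have "infinite (S - E)" "infinite (T - E)"
    using D(1) by (auto intro!: infinite_super[OF _ D(2)] simp: E_def)
  then obtain g where g: "bij_betw g S T" "\<forall>x\<in>E. g x = x"
    using bij_betw_extending_identity[of E S T] by (auto simp: E_def)
  define f where "f = (\<lambda>x. if x \<in> S then g x else h x)"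
  have "structure_iso A B f"
    using structure_iso_replace_on_singletons[OF assms(1,2) h] g(1)
    by (simp add: f_def S_def T_def)
  moreover have "has_asymptotic_density {x. f x = x} 1"
  proof -
    have "- {x. f x = x} \<subseteq> - (S \<inter> T) \<union> D"
      using g(2) by (auto simp: f_def E_def)
    then show ?thesis
      using has_asymptotic_density_zero_mono[OF has_asymptotic_density_zero_Un[OF null_ST D(3)]]
      by (simp add: has_asymptotic_density_one_iff_compl)
  qed
  ultimately show ?thesis
    unfolding coarsely_computably_isomorphic_def
    using coarsely_computable_iso_if_mostly_identity by blast
qed

end
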